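(* Let $n\in\{0,1,2,\dots\}$, let $\sigma(t)$ be a known, sufficiently smooth and positive function of time, and let $$f_n^1(x,t)=\frac{1}{2^n n!}\,\frac{1}{\sqrt{2\pi}\,\sigma(t)}\exp\left(-\frac{x^2}{2\sigma^2(t)}\right)H_n^2\left(\frac{x}{\sqrt2\,\sigma(t)}\right).$$ Let $f_n^1$ satisfy the first Vlasov equation $$\frac{\partial f_n^1}{\partial t}+\langle v\rangle_1\frac{\partial f_n^1}{\partial x}+f_n^1\frac{\partial\langle v\rangle_1}{\partial x}=0,$$ where $\langle v\rangle_1(x,t)$ is the average velocity of the probability flow. Put $\tilde x(x,t)=\dfrac{x}{\sqrt2\,\sigma(t)}$ and $\langle\tilde v\rangle_1(\tilde x,t)=\langle v\rangle_1\big(\tilde x\sqrt2\,\sigma(t),t\big)=\langle v\rangle_1(x,t)$. Then the field $\langle v\rangle_1$ satisfies the equation $$\frac{\partial\langle\tilde v\rangle_1}{\partial\tilde x}+2\langle\tilde v\rangle_1\left[-\tilde x+2n\frac{H_{n-1}(\tilde x)}{H_n(\tilde x)}\right]=2\sqrt2\left[-\tilde x^2+2n\frac{H_{n-1}(\tilde x)}{H_n(\tilde x)}\tilde x+\frac12\right]\dot\sigma .$$ In this case, the solution of this equation has the form $$\langle v\rangle_{1|n}(x,t)=\frac{C}{H_n^2\left(\frac{x}{\sqrt2\,\sigma(t)}\right)}\exp\left(\frac{x^2}{2\sigma(t)^2}\right)+\frac{\dot\sigma(t)}{\sigma(t)}\,x,\qquad n=0,1,\dots,$$ where $C$ does not depend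 on the coordinate $x$.
   Context: $x\in\mathbb{R}$ is the coordinate and $t$ is time. $H_n$ denotes the Hermite polynomial of degree $n$ in the physicists' convention (so $H_n'=2nH_{n-1}$); for $n=0$ the terms containing the factor $2nH_{n-1}/H_n$ are understood to be $0$. $\dot\sigma$ is the time derivative of $\sigma(t)$. $\langle v\rangle_{1|n}$ denotes the velocity field $\langle v\rangle_1$ corresponding to the density $f_n^1$.
   Formalization: The equations are taken off the zeros of H_n; there C is constant on each interval between zeros (different values can occur when n ≥ 1), and a single C for all x is claimed only when the flux f⟨v⟩ extends continuously across the zeros. *)

theory Defs
  imports "HOL-Analysis.Analysis" "HOL-Computational_Algebra.Polynomial"
begin

fun hermite :: "nat \<Rightarrow> real poly" where
  "hermite 0 = 1"
| "hermite (Suc 0) = [:0, 2:]"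
| "hermite (Suc (Suc n)) = [:0, 2:] * hermite (Suc n) - smult (2 * real (Suc n)) (hermite n)"

abbreviation H :: "nat \<Rightarrow> real \<Rightarrow> real" where
  "H n y \<equiv> poly (hermite n) y"

text \<open>The next lemmas confirm the physicists' normalisation: \<open>H\<^sub>n\<close> has degree \<open>n\<close> and leading
  coefficient \<open>2\<^sup>n\<close>, \<open>H\<^sub>n' = 2 n H\<^sub>n\<^sub>-\<^sub>1\<close>, and Rodrigues' formula holds.\<close>

lemma pderiv_hermite: "pderiv (hermite n) = smult (2 * real n) (hermite (n - 1))"
proof (induction n rule: hermite.induct)
  case (3 n)
  have p: "pderiv [:0, 2 :: real:] = [:2:]"
    by (simp add: pderiv_pCons)
  have m: "r * [:2:] = smult 2 r" for r :: "real poly"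
    by simp
  have q: "smult (2 * real (Suc n)) (hermite (Suc n))
      = [:0, 2:] * smult (2 * real (Suc n)) (hermite n)
        - smult (2 * real (Suc n)) (smult (2 * real n) (hermite (n - 1)))"
    by (cases n) (simp_all add: smult_diff_right algebra_simps)
  have "pderiv (hermite (Suc (Suc n)))
      = [:0, 2:] * smult (2 * real (Suc n)) (hermite n) + smult 2 (hermite (Suc n))
        - smult (2 * real (Suc n)) (smult (2 * real n) (hermite (n - 1)))"
    unfolding hermite.simps pderiv_diff pderiv_mult pderiv_smult p 3 m diff_Suc_1
    by (rule refl)
  also have "\<dots> = smult (2 * real (Suc n)) (hermite (Suc n)) + smult 2 (hermite (Suc n))"
    unfolding q by simp
  also have "\<dots> = smult (2 * real (Suc (Suc n))) (hermite (Suc n))"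
    by (simp add: smult_add_left [symmetric] algebra_simps)
  finally show ?case by simp
qed (simp_all add: pderiv_pCons one_pCons)

lemma hermite_Suc: "hermite (Suc n) = [:0, 2:] * hermite n - pderiv (hermite n)"
  by (cases n) (simp_all add: pderiv_hermite)

lemma degree_hermite: "degree (hermite n) = n \<and> lead_coeff (hermite n) = 2 ^ n"
proof (induction n rule: hermite.induct)
  case (3 n)
  let ?p = "pCons 0 (smult 2 (hermite (Suc n)))" and ?q = "smult (2 * real (Suc n)) (hermite n)"
  have e: "hermite (Suc (Suc n)) = ?p - ?q" by simp
  have nz: "hermite (Suc n) \<noteq> 0" using 3 by (metis degree_0 nat.distinct(1))
  then have dp: "degree ?p = Suc (Suc n)" using 3 by simp
  have dq: "degree ?q < Suc (Suc n)" using 3 by simp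
  have d: "degree (?p - ?q) = Suc (Suc n)"
    using degree_add_eq_left [of "- ?q" ?p] dp dq by simp
  moreover have "coeff (?p - ?q) (Suc (Suc n)) = 2 ^ Suc (Suc n)"
    using 3 dq by (auto simp: coeff_eq_0)
  ultimately show ?case unfolding e by simp
qed simp_all

lemma Rodrigues_hermite:
  "(deriv ^^ n) (\<lambda>y. exp (- (y\<^sup>2))) = (\<lambda>y::real. (- 1) ^ n * H n y * exp (- (y\<^sup>2)))"
proof (induction n)
  case (Suc n)
  have "((\<lambda>y::real. (- 1) ^ n * H n y * exp (- (y\<^sup>2))) has_real_derivative
      (- 1) ^ Suc n * H (Suc n) y * exp (- (y\<^sup>2))) (at y)" for y
    by (auto intro!: derivative_eq_intros poly_DERIV simp: hermite_Suc algebra_simps)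
  then show ?case
    using Suc by (auto intro!: ext DERIV_imp_deriv)
qed simp

definition vlasov_density :: "nat \<Rightarrow> (real \<Rightarrow> real) \<Rightarrow> real \<Rightarrow> real \<Rightarrow> real" where
  "vlasov_density n \<sigma> x t =
     1 / (2 ^ n * fact n) * (1 / (sqrt (2 * pi) * \<sigma> t)) * exp (- (x\<^sup>2 / (2 * (\<sigma> t)\<^sup>2)))
       * (H n (x / (sqrt 2 * \<sigma> t)))\<^sup>2"

definition first_vlasov_at ::
  "(real \<Rightarrow> real \<Rightarrow> real) \<Rightarrow> (real \<Rightarrow> real \<Rightarrow> real) \<Rightarrow> real \<Rightarrow> real \<Rightarrow> bool" where
  "first_vlasov_at f v x t \<longleftrightarrow>
     (\<lambda>s. f x s) differentiable (at t) \<and>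
     (\<lambda>z. f z t) differentiable (at x) \<and>
     (\<lambda>z. v z t) differentiable (at x) \<and>
     deriv (\<lambda>s. f x s) t + v x t * deriv (\<lambda>z. f z t) x + f x t * deriv (\<lambda>z. v z t) x = 0"

definition scaled_coord :: "(real \<Rightarrow> real) \<Rightarrow> real \<Rightarrow> real \<Rightarrow> real" where
  "scaled_coord \<sigma> x t = x / (sqrt 2 * \<sigma> t)"

definition scaled_field :: "(real \<Rightarrow> real) \<Rightarrow> (real \<Rightarrow> real \<Rightarrow> real) \<Rightarrow> real \<Rightarrow> real \<Rightarrow> real" where
  "scaled_field \<sigma> v y t = v (y * sqrt 2 * \<sigma> t) t"

text \<open>For \<open>n = 0\<close> the factor \<open>real n\<close> makes the terms with \<open>H (n - 1) y / H n y\<close> vanish.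
  Where \<open>H n y = 0\<close> this predicate has no mathematical content (the quotient is then a
  default value), so it is to be used only off the zeros of \<open>H n\<close>.\<close>

definition velocity_equation_at ::
  "nat \<Rightarrow> (real \<Rightarrow> real) \<Rightarrow> (real \<Rightarrow> real \<Rightarrow> real) \<Rightarrow> real \<Rightarrow> real \<Rightarrow> bool" where
  "velocity_equation_at n \<sigma> v y t \<longleftrightarrow>
     (\<lambda>z. scaled_field \<sigma> v z t) differentiable (at y) \<and>
     deriv (\<lambda>z. scaled_field \<sigma> v z t) y
       + 2 * scaled_field \<sigma> v y t * (- y + 2 * real n * (H (n - 1) y / H n y))
     = 2 * sqrt 2 * (- (y\<^sup>2) + 2 * real n * (H (n - 1) y / H n y) * y + 1 / 2) * deriv \<sigma> t"

definition velocity_solution :: "nat \<Rightarrow> (real \<Rightarrow> real) \<Rightarrow> real \<Rightarrow> real \<Rightarrow> real \<Rightarrow> real" where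
  "velocity_solution n \<sigma> C x t =
     C / (H n (x / (sqrt 2 * \<sigma> t)))\<^sup>2 * exp (x\<^sup>2 / (2 * (\<sigma> t)\<^sup>2)) + deriv \<sigma> t / \<sigma> t * x"

text \<open>The points at which the density is positive, that is, at which an average velocity makes
  sense.\<close>

definition off_nodes :: "nat \<Rightarrow> (real \<Rightarrow> real) \<Rightarrow> real \<Rightarrow> real set" where
  "off_nodes n \<sigma> t = {x. H n (scaled_coord \<sigma> x t) \<noteq> 0}"

text \<open>The probability flux \<open>f v\<close> has no jump at the nodes. The product itself is not used there,
  because at a node the velocity may be singular while the density vanishes.\<close>

definition flux_extends_continuously ::
  "nat \<Rightarrow> (real \<Rightarrow> real) \<Rightarrow> (real \<Rightarrow> real \<Rightarrow> real) \<Rightarrow> real \<Rightarrow> bool" where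
  "flux_extends_continuously n \<sigma> v t \<longleftrightarrow>
     (\<exists>J. continuous_on UNIV J \<and> (\<forall>x\<in>off_nodes n \<sigma> t. J x = vlasov_density n \<sigma> x t * v x t))"

end

theory Submission
  imports Defs
begin

text \<open>Up to a factor depending only on time, the density is \<open>w x = exp (- y\<^sup>2) (H n y)\<^sup>2\<close> with
  \<open>y = x / (sqrt 2 \<sigma>)\<close>. As the density is \<open>g (x / \<sigma>) / \<sigma>\<close>, its time derivative is
  \<open>- (\<sigma>' / \<sigma>) \<partial>\<^sub>x (x f)\<close>, so both the Vlasov equation and the velocity equation
  say that \<open>w x (v x - (\<sigma>' / \<sigma>) x)\<close> has derivative zero in \<open>x\<close>. This product is therefore constant
  between nodes, and, if the flux is continuous, constant across the finitely many nodes.\<close>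

section \<open>The weight, the drift-free flux and their derivatives\<close>

definition hermite_weight :: "nat \<Rightarrow> real \<Rightarrow> real \<Rightarrow> real" where
  "hermite_weight n s x = exp (- (x\<^sup>2 / (2 * s\<^sup>2))) * (H n (x / (sqrt 2 * s)))\<^sup>2"

text \<open>One factor \<open>H n\<close> is left outside and nothing is divided by it, so the
  formula also holds at the nodes. Off the nodes, dividing by the weight yields the quotient
  \<open>H (n - 1) y / H n y\<close> of the velocity equation.\<close>

definition hermite_weight_deriv :: "nat \<Rightarrow> real \<Rightarrow> real \<Rightarrow> real" where
  "hermite_weight_deriv n s x =
     exp (- (x\<^sup>2 / (2 * s\<^sup>2))) * (sqrt 2 / s) * H n (x / (sqrt 2 * s)) *
       (2 * real n * H (n - 1) (x / (sqrt 2 * s)) - x / (sqrt 2 * s) * H n (x / (sqrt 2 * s)))"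

definition drift_free_flux :: "nat \<Rightarrow> real \<Rightarrow> real \<Rightarrow> (real \<Rightarrow> real) \<Rightarrow> real \<Rightarrow> real" where
  "drift_free_flux n s a u x = hermite_weight n s x * (u x - a * x)"

lemma has_derivative_H [derivative_intros]:
  assumes "(g has_real_derivative g') (at x within S)"
  shows "((\<lambda>x. H n (g x)) has_real_derivative 2 * real n * H (n - 1) (g x) * g') (at x within S)"
  using DERIV_chain2 [OF poly_DERIV assms, of "hermite n"] by (simp add: pderiv_hermite)

text \<open>Serves both for the derivative in space (\<open>g' = 1\<close>, \<open>s' = 0\<close>) and for that in time
  (\<open>g' = 0\<close>).\<close>

lemma has_derivative_hermite_weight:
  assumes g: "(g has_real_derivative g') (at t)" and s: "(s has_real_derivative s') (at t)"
    and nz: "s t \<noteq> 0"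
  shows "((\<lambda>t. hermite_weight n (s t) (g t)) has_real_derivative
      hermite_weight_deriv n (s t) (g t) * (g' - g t * s' / s t)) (at t)"
proof -
  \<comment> \<open>The weight depends on \<open>s\<close> and \<open>g\<close> only through their
    quotient, so the chain rule through \<open>y\<close> covers any joint variation of the
    two.\<close>
  define y where "y t = g t / (sqrt 2 * s t)" for t
  have w: "hermite_weight n (s t) (g t) = exp (- (y t)\<^sup>2) * (H n (y t))\<^sup>2" for t
    by (simp add: hermite_weight_def y_def power_divide power_mult_distrib)
  have y': "(y has_real_derivative (g' - g t * s' / s t) / (sqrt 2 * s t)) (at t)"
    unfolding y_def using nz
    by (auto intro!: derivative_eq_intros g s simp: field_simps)
  have d: "hermite_weight_deriv n (s t) (g t) =
      exp (- (y t)\<^sup>2) * (sqrt 2 / s t) * H n (y t) *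
        (2 * real n * H (n - 1) (y t) - y t * H n (y t))"
    by (simp add: hermite_weight_deriv_def y_def power_divide power_mult_distrib)
  have "2 / (sqrt 2 * s t) = sqrt 2 / s t"
    using nz by (simp add: field_simps)
  moreover have "((\<lambda>t. exp (- (y t)\<^sup>2) * (H n (y t))\<^sup>2) has_real_derivative
      exp (- (y t)\<^sup>2) * (2 / (sqrt 2 * s t)) * H n (y t) *
        (2 * real n * H (n - 1) (y t) - y t * H n (y t)) * (g' - g t * s' / s t)) (at t)"
    by (rule derivative_eq_intros y' refl)+
      (simp add: power2_eq_square add_divide_distrib diff_divide_distrib algebra_simps)
  ultimately show ?thesis
    unfolding w d by simp
qed

lemma DERIV_hermite_weight:
  assumes "s \<noteq> 0"
  shows "(hermite_weight n s has_real_derivative hermite_weight_deriv n s x) (at x)"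
  using has_derivative_hermite_weight [OF DERIV_ident DERIV_const [of s] assms, of n x] by simp

lemma hermite_weight_eq_0_iff: "hermite_weight n (\<sigma> t) x = 0 \<longleftrightarrow> x \<notin> off_nodes n \<sigma> t"
  by (simp add: hermite_weight_def off_nodes_def scaled_coord_def)

lemma vlasov_density_eq:
  "vlasov_density n \<sigma> x t = hermite_weight n (\<sigma> t) x / (2 ^ n * fact n * sqrt (2 * pi) * \<sigma> t)"
  by (simp add: vlasov_density_def hermite_weight_def)

text \<open>No restriction to \<open>off_nodes\<close> is needed: at a node both quotients are
  divisions by zero and have the value 0.\<close>

lemma velocity_solution_eq:
  "velocity_solution n \<sigma> C x t = C / hermite_weight n (\<sigma> t) x + deriv \<sigma> t / \<sigma> t * x"
  by (simp add: velocity_solution_def hermite_weight_def exp_minus field_simps)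

text \<open>Off the nodes the weight can be divided out. This identifies \<open>C\<close> as the
  value of the drift-free flux, so finding \<open>C\<close> amounts to showing that this flux is
  constant.\<close>

lemma velocity_solution_iff:
  assumes "x \<in> off_nodes n \<sigma> t"
  shows "u x t = velocity_solution n \<sigma> C x t \<longleftrightarrow>
    drift_free_flux n (\<sigma> t) (deriv \<sigma> t / \<sigma> t) (\<lambda>x. u x t) x = C"
  using assms hermite_weight_eq_0_iff [of n \<sigma> t x]
  by (auto simp: velocity_solution_eq drift_free_flux_def field_simps)

lemma DERIV_drift_free_flux:
  assumes "s \<noteq> 0" "(u has_real_derivative D) (at x)"
  shows "(drift_free_flux n s a u has_real_derivative
      hermite_weight_deriv n s x * (u x - a * x) + hermite_weight n s x * (D - a)) (at x)"
  unfolding drift_free_flux_def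
  by (rule derivative_eq_intros DERIV_hermite_weight assms refl)+ (simp add: algebra_simps)

section \<open>Both equations as conservation of the drift-free flux\<close>

text \<open>Multiplied by the normalising factor \<open>k * \<sigma> t\<close>, the Vlasov equation
  is the product rule for the drift-free flux. There is no division by the weight, so
  \<open>x\<close> may be a node.\<close>

lemma first_vlasov_at_imp_DERIV_flux_0:
  assumes s: "\<sigma> t > 0" and d: "\<sigma> differentiable (at t)"
    and v: "first_vlasov_at (vlasov_density n \<sigma>) v x t"
  shows "(\<lambda>z. v z t) differentiable (at x)"
    and "(drift_free_flux n (\<sigma> t) (deriv \<sigma> t / \<sigma> t) (\<lambda>z. v z t) has_real_derivative 0) (at x)"
proof -
  define k :: real where "k = 2 ^ n * fact n * sqrt (2 * pi)"
  have k: "k > 0" by (simp add: k_def)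
  note f = vlasov_density_eq [of n \<sigma>, folded k_def]
  let ?w = "hermite_weight n (\<sigma> t) x" and ?w' = "hermite_weight_deriv n (\<sigma> t) x"
  show vd: "(\<lambda>z. v z t) differentiable (at x)"
    using v by (simp add: first_vlasov_at_def)
  have \<sigma>': "(\<sigma> has_real_derivative deriv \<sigma> t) (at t)"
    using d by (simp add: DERIV_deriv_iff_real_differentiable)
  \<comment> \<open>Two contributions: the prefactor 1 / \<open>\<sigma>\<close> gives the term with
    \<open>?w\<close>, and the change of width inside the weight, at fixed \<open>x\<close>, gives
    the term with \<open>x * ?w'\<close>.\<close>
  have "((\<lambda>\<tau>. vlasov_density n \<sigma> x \<tau>) has_real_derivative
      - (deriv \<sigma> t / \<sigma> t) * (?w + x * ?w') / (k * \<sigma> t)) (at t)"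
    unfolding f using s k
    by (auto intro!: derivative_eq_intros has_derivative_hermite_weight \<sigma>' simp: field_simps)
  then have 1: "deriv (\<lambda>\<tau>. vlasov_density n \<sigma> x \<tau>) t =
      - (deriv \<sigma> t / \<sigma> t) * (?w + x * ?w') / (k * \<sigma> t)"
    by (rule DERIV_imp_deriv)
  have "((\<lambda>z. vlasov_density n \<sigma> z t) has_real_derivative ?w' / (k * \<sigma> t)) (at x)"
    unfolding f using s by (intro DERIV_cdivide DERIV_hermite_weight) simp
  then have 2: "deriv (\<lambda>z. vlasov_density n \<sigma> z t) x = ?w' / (k * \<sigma> t)"
    by (rule DERIV_imp_deriv)
  define D where "D = deriv (\<lambda>z. v z t) x"
  have D: "((\<lambda>z. v z t) has_real_derivative D) (at x)"
    using vd by (simp add: D_def DERIV_deriv_iff_real_differentiable)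
  have "- (deriv \<sigma> t / \<sigma> t) * (?w + x * ?w') / (k * \<sigma> t) + v x t * (?w' / (k * \<sigma> t))
      + ?w / (k * \<sigma> t) * D = 0"
    using v unfolding first_vlasov_at_def 1 2 D_def [symmetric] by (simp add: f)
  then have "(?w' * (v x t - deriv \<sigma> t / \<sigma> t * x) + ?w * (D - deriv \<sigma> t / \<sigma> t)) / (k * \<sigma> t) = 0"
    by (simp add: add_divide_distrib diff_divide_distrib algebra_simps)
  then have "?w' * (v x t - deriv \<sigma> t / \<sigma> t * x) + ?w * (D - deriv \<sigma> t / \<sigma> t) = 0"
    using s k by simp
  then show "(drift_free_flux n (\<sigma> t) (deriv \<sigma> t / \<sigma> t) (\<lambda>z. v z t) has_real_derivative 0) (at x)"
    using DERIV_drift_free_flux [OF _ D, of "\<sigma> t" n "deriv \<sigma> t / \<sigma> t"] s by simp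
qed

text \<open>Multiplying the velocity equation by the weight, which is nonzero off the nodes, gives
  \<open>sqrt 2 * \<sigma> t\<close> times the derivative of the drift-free flux; the extra factor
  comes from differentiating in the scaled coordinate instead of \<open>x\<close>.\<close>

lemma velocity_equation_at_iff:
  assumes s: "\<sigma> t > 0" and x: "x \<in> off_nodes n \<sigma> t"
  shows "velocity_equation_at n \<sigma> u (scaled_coord \<sigma> x t) t \<longleftrightarrow>
    (\<lambda>z. u z t) differentiable (at x) \<and>
    (drift_free_flux n (\<sigma> t) (deriv \<sigma> t / \<sigma> t) (\<lambda>z. u z t) has_real_derivative 0) (at x)"
proof -
  let ?c = "sqrt 2 * \<sigma> t" and ?y = "scaled_coord \<sigma> x t"
  have c: "?c > 0" using s by simp
  have yx: "?y * ?c = x" using s by (simp add: scaled_coord_def)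
  have sf: "scaled_field \<sigma> u z t = u (z * ?c) t" for z
    by (simp add: scaled_field_def mult.assoc)
  have fwd: "((\<lambda>z. scaled_field \<sigma> u z t) has_real_derivative ?c * D) (at ?y)"
    if "((\<lambda>z. u z t) has_real_derivative D) (at x)" for D
  proof -
    have "((\<lambda>z. z * ?c) has_real_derivative ?c) (at ?y)"
      by (auto intro!: derivative_eq_intros)
    from DERIV_chain2 [OF _ this, of "\<lambda>z. u z t" D, unfolded yx] that show ?thesis
      by (simp add: sf mult.commute)
  qed
  \<comment> \<open>\<open>velocity_equation_at\<close> asserts differentiability of the scaled
    field only; undoing the scaling carries it back to \<open>u\<close>.\<close>
  have bwd: "(\<lambda>z. u z t) differentiable (at x)"
    if "(\<lambda>z. scaled_field \<sigma> u z t) differentiable (at ?y)"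
  proof -
    from that obtain D where D: "((\<lambda>z. scaled_field \<sigma> u z t) has_real_derivative D) (at ?y)"
      by (auto simp: real_differentiable_def)
    have "((\<lambda>z. z / ?c) has_real_derivative 1 / ?c) (at x)"
      by (intro DERIV_cdivide DERIV_ident)
    from DERIV_chain2 [OF D [unfolded scaled_coord_def] this]
    have "((\<lambda>z. u z t) has_real_derivative D * (1 / ?c)) (at x)"
      using s by (simp add: sf)
    then show ?thesis
      using real_differentiable_def by blast
  qed
  have iff: "velocity_equation_at n \<sigma> u ?y t \<longleftrightarrow>
      (drift_free_flux n (\<sigma> t) (deriv \<sigma> t / \<sigma> t) (\<lambda>z. u z t) has_real_derivative 0) (at x)"
    if D: "((\<lambda>z. u z t) has_real_derivative D) (at x)" for D
  proof -
    let ?w = "hermite_weight n (\<sigma> t) x" and ?w' = "hermite_weight_deriv n (\<sigma> t) x"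
    let ?R = "2 * real n * (H (n - 1) ?y / H n ?y)" and ?a = "deriv \<sigma> t / \<sigma> t"
    have w: "?w \<noteq> 0" using x by (simp add: hermite_weight_eq_0_iff)
    have h: "H n ?y \<noteq> 0" using x by (simp add: off_nodes_def)
    \<comment> \<open>This is the logarithmic derivative of the weight, the source of the bracket in
      the velocity equation.\<close>
    have w': "?w' = ?w * (sqrt 2 / \<sigma> t) * (?R - ?y)"
    proof -
      have "e * q * h * (2 * m * g - y * h) = e * h\<^sup>2 * q * (2 * m * (g / h) - y)"
        if "h \<noteq> 0" for e q h m g y :: real
        using that by (simp add: power2_eq_square field_simps)
      from this [OF h] show ?thesis
        unfolding hermite_weight_deriv_def hermite_weight_def scaled_coord_def [symmetric] .
    qed
    \<comment> \<open>The right-hand side of the velocity equation collects the drift terms: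
      \<open>?a * x\<close> inside the flux gives the quadratic part, and its derivative
      \<open>?a\<close> gives the summand 1 / 2.\<close>
    have id: "?c * (?w' * (u x t - ?a * x) + ?w * (D - ?a)) =
      ?w * (?c * D + 2 * u x t * (- ?y + ?R)
        - 2 * sqrt 2 * (- (?y\<^sup>2) + ?R * ?y + 1 / 2) * deriv \<sigma> t)"
    proof -
      have c1: "?c * (sqrt 2 / \<sigma> t) = 2" and c2: "?a * x = sqrt 2 * deriv \<sigma> t * ?y"
        and c3: "?c * ?a = sqrt 2 * deriv \<sigma> t"
        using s by (simp_all add: scaled_coord_def)
      have "c * (W * p * (R - y) * Z + W * (D - a)) = W * (c * p * (R - y) * Z + c * D - c * a)"
        for c W p R y Z D a :: real
        by (simp add: algebra_simps)
      from this [of ?c ?w "sqrt 2 / \<sigma> t" ?R ?y "u x t - ?a * x" D ?a]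
      have "?c * (?w' * (u x t - ?a * x) + ?w * (D - ?a)) = ?w * (2 * (?R - ?y)
          * (u x t - sqrt 2 * deriv \<sigma> t * ?y) + ?c * D - sqrt 2 * deriv \<sigma> t)"
        by (simp only: w' c1 c2 c3)
      moreover have "2 * (R - y) * (U - q * e * y) + E - q * e =
          E + 2 * U * (- y + R) - 2 * q * (- (y\<^sup>2) + R * y + 1 / 2) * e"
        for R y U q e E :: real
        by (simp add: algebra_simps power2_eq_square)
      ultimately show ?thesis
        by (simp only:)
    qed
    have "(\<lambda>z. scaled_field \<sigma> u z t) differentiable (at ?y)"
      using fwd [OF D] real_differentiable_def by blast
    moreover have "deriv (\<lambda>z. scaled_field \<sigma> u z t) ?y = ?c * D"
      using fwd [OF D] by (rule DERIV_imp_deriv)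
    moreover have "scaled_field \<sigma> u ?y t = u x t"
      by (simp add: sf yx)
    ultimately have "velocity_equation_at n \<sigma> u ?y t \<longleftrightarrow>
        ?c * D + 2 * u x t * (- ?y + ?R)
          - 2 * sqrt 2 * (- (?y\<^sup>2) + ?R * ?y + 1 / 2) * deriv \<sigma> t = 0"
      by (simp add: velocity_equation_at_def)
    also have "\<dots> \<longleftrightarrow> ?w' * (u x t - ?a * x) + ?w * (D - ?a) = 0"
    proof -
      have "A = 0 \<longleftrightarrow> B = 0" if "c * B = w * A" "w \<noteq> 0" "c > 0" for A B c w :: real
        using that by auto
      from this [OF id w c] show ?thesis .
    qed
    also have "\<dots> \<longleftrightarrow>
        (drift_free_flux n (\<sigma> t) ?a (\<lambda>z. u z t) has_real_derivative 0) (at x)"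
    proof -
      have "\<sigma> t \<noteq> 0" using s by simp
      from DERIV_drift_free_flux [OF this D, of n ?a] show ?thesis
        by (metis DERIV_unique)
    qed
    finally show ?thesis .
  qed
  show ?thesis
  proof (intro iffI conjI)
    assume vel: "velocity_equation_at n \<sigma> u ?y t"
    then show d: "(\<lambda>z. u z t) differentiable (at x)"
      by (intro bwd) (simp add: velocity_equation_at_def)
    then obtain D where "((\<lambda>z. u z t) has_real_derivative D) (at x)"
      by (auto simp: real_differentiable_def)
    with vel show "(drift_free_flux n (\<sigma> t) (deriv \<sigma> t / \<sigma> t) (\<lambda>z. u z t)
        has_real_derivative 0) (at x)"
      using iff by blast
  next
    assume *: "(\<lambda>z. u z t) differentiable (at x) \<and>
      (drift_free_flux n (\<sigma> t) (deriv \<sigma> t / \<sigma> t) (\<lambda>z. u z t) has_real_derivative 0) (at x)"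
    then obtain D where "((\<lambda>z. u z t) has_real_derivative D) (at x)"
      by (auto simp: real_differentiable_def)
    with * show "velocity_equation_at n \<sigma> u ?y t"
      using iff by blast
  qed
qed

section \<open>Integration on node-free intervals and across the nodes\<close>

text \<open>The nodes are rescaled roots of a nonzero polynomial. Their finiteness makes
  \<open>off_nodes\<close> open and allows them as exceptional points in the constancy argument
  across nodes.\<close>

lemma finite_nodes:
  assumes "\<sigma> t \<noteq> 0"
  shows "finite (- off_nodes n \<sigma> t)"
proof -
  have "hermite n \<noteq> 0"
    using degree_hermite [of n] by auto
  then have "finite {y. H n y = 0}"
    by (rule poly_roots_finite)
  then have "finite ((\<lambda>y. y * (sqrt 2 * \<sigma> t)) ` {y. H n y = 0})"
    by (rule finite_imageI)
  moreover have "- off_nodes n \<sigma> t \<subseteq> (\<lambda>y. y * (sqrt 2 * \<sigma> t)) ` {y. H n y = 0}"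
    using assms by (force simp: off_nodes_def scaled_coord_def image_iff)
  ultimately show ?thesis
    by (rule finite_subset [rotated])
qed

text \<open>A zero derivative gives one constant because \<open>I\<close> is connected; different
  components of \<open>off_nodes\<close> may carry different constants. Conversely, openness of
  \<open>I\<close> lets derivatives be read off from the closed form.\<close>

lemma velocity_equation_on_iff:
  assumes s: "\<sigma> t > 0" and I: "open I" "connected I" "I \<subseteq> off_nodes n \<sigma> t"
  shows "(\<forall>x\<in>I. velocity_equation_at n \<sigma> u (scaled_coord \<sigma> x t) t)
    \<longleftrightarrow> (\<exists>C. \<forall>x\<in>I. u x t = velocity_solution n \<sigma> C x t)"
    (is "?L \<longleftrightarrow> ?R")
proof
  let ?Q = "drift_free_flux n (\<sigma> t) (deriv \<sigma> t / \<sigma> t) (\<lambda>z. u z t)"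
  note eq_iff = velocity_equation_at_iff [where \<sigma> = \<sigma> and t = t and u = u, OF s]
  show ?R if ?L
  proof -
    have "(?Q has_real_derivative 0) (at x)" if "x \<in> I" for x
      using that \<open>?L\<close> eq_iff I(3) by blast
    then have "\<exists>C. \<forall>x\<in>I. ?Q x = C"
      using has_field_derivative_0_imp_constant_on [OF _ I(2,1), of ?Q]
      unfolding constant_on_def by blast
    then obtain C where C: "\<And>x. x \<in> I \<Longrightarrow> ?Q x = C"
      by blast
    have "u x t = velocity_solution n \<sigma> C x t" if "x \<in> I" for x
      using velocity_solution_iff [of x n \<sigma> t u C] C [OF that] that I(3) by auto
    then show ?thesis
      by blast
  qed
  show ?L if ?R
  proof
    fix x assume x: "x \<in> I"
    from that obtain C where C: "\<And>z. z \<in> I \<Longrightarrow> u z t = velocity_solution n \<sigma> C z t"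
      by blast
    \<comment> \<open>Constancy of \<open>?Q\<close> is only half of what \<open>eq_iff\<close>
      demands. Differentiability of \<open>u\<close> comes from the closed form, whose denominator
      does not vanish on \<open>I\<close>.\<close>
    have "(\<lambda>z. C / hermite_weight n (\<sigma> t) z + deriv \<sigma> t / \<sigma> t * z) field_differentiable (at x)"
    proof (intro derivative_intros)
      show "hermite_weight n (\<sigma> t) field_differentiable (at x)"
        using s DERIV_hermite_weight [of "\<sigma> t" n x] field_differentiable_def by auto
      show "hermite_weight n (\<sigma> t) x \<noteq> 0"
        using x I(3) by (auto simp: hermite_weight_eq_0_iff)
    qed
    then obtain D where
      "((\<lambda>z. C / hermite_weight n (\<sigma> t) z + deriv \<sigma> t / \<sigma> t * z) has_real_derivative D) (at x)"
      by (auto simp: field_differentiable_def)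
    then have "((\<lambda>z. u z t) has_real_derivative D) (at x)"
      by (rule has_field_derivative_transform_within_open [OF _ I(1) x])
        (simp add: C velocity_solution_eq)
    then have "(\<lambda>z. u z t) differentiable (at x)"
      using real_differentiable_def by blast
    moreover have "(?Q has_real_derivative 0) (at x)"
    proof (rule has_field_derivative_transform_within_open [OF DERIV_const I(1) x])
      show "C = ?Q z" if "z \<in> I" for z
        using C [OF that] velocity_solution_iff [of z n \<sigma> t u C] that I(3) by auto
    qed
    ultimately show "velocity_equation_at n \<sigma> u (scaled_coord \<sigma> x t) t"
      using eq_iff x I(3) by blast
  qed
qed

text \<open>The continuous extension of the flux glues the constants of neighbouring intervals: a
  continuous function on the line with zero derivative off a finite set is constant.\<close>

lemma continuous_flux_imp_velocity_solution:
  assumes s: "\<sigma> t > 0" and J: "flux_extends_continuously n \<sigma> v t"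
    and Q: "\<And>x. x \<in> off_nodes n \<sigma> t \<Longrightarrow>
      (drift_free_flux n (\<sigma> t) (deriv \<sigma> t / \<sigma> t) (\<lambda>z. v z t) has_real_derivative 0) (at x)"
  shows "\<exists>C. \<forall>x\<in>off_nodes n \<sigma> t. v x t = velocity_solution n \<sigma> C x t"
proof -
  let ?a = "deriv \<sigma> t / \<sigma> t"
  let ?Q = "drift_free_flux n (\<sigma> t) ?a (\<lambda>z. v z t)"
  define k :: real where "k = 2 ^ n * fact n * sqrt (2 * pi) * \<sigma> t"
  have k: "k > 0" using s by (simp add: k_def)
  from J obtain J where J: "continuous_on UNIV J"
    "\<And>x. x \<in> off_nodes n \<sigma> t \<Longrightarrow> J x = vlasov_density n \<sigma> x t * v x t"
    by (auto simp: flux_extends_continuously_def)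
  \<comment> \<open>At a node \<open>?Q\<close> is 0 because the weight vanishes, whatever its
    values nearby, so it need not be continuous there. \<open>G\<close> replaces density times
    velocity by the extension \<open>J\<close>, and \<open>k\<close> undoes the
    normalisation.\<close>
  define G where "G x = k * J x - hermite_weight n (\<sigma> t) x * (?a * x)" for x
  have GQ: "?Q x = G x" if "x \<in> off_nodes n \<sigma> t" for x
  proof -
    have "vlasov_density n \<sigma> x t = hermite_weight n (\<sigma> t) x / k"
      unfolding k_def by (rule vlasov_density_eq)
    then show ?thesis
      using J(2) [OF that] k by (simp add: G_def drift_free_flux_def right_diff_distrib)
  qed
  have "continuous_on UNIV (hermite_weight n (\<sigma> t))"
    using s DERIV_hermite_weight [of "\<sigma> t" n] by (intro DERIV_continuous_on) auto
  then have G: "continuous_on UNIV G"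
    unfolding G_def by (intro continuous_intros J(1))
  have fin: "finite (- off_nodes n \<sigma> t)"
    using s by (intro finite_nodes) simp
  then have op: "open (off_nodes n \<sigma> t)"
    using finite_imp_closed [OF fin] by (simp add: closed_def)
  have "(G has_real_derivative 0) (at x)" if "x \<in> off_nodes n \<sigma> t" for x
    using has_field_derivative_transform_within_open [OF Q [OF that] op that GQ] .
  then obtain C where "\<And>x. G x = C"
    using DERIV_zero_connected_constant [OF connected_UNIV open_UNIV fin G] by auto
  then have "v x t = velocity_solution n \<sigma> C x t" if "x \<in> off_nodes n \<sigma> t" for x
    using velocity_solution_iff [OF that, of v C] GQ [OF that] by simp
  then show ?thesis
    by blast
qed

theorem theorem1:
  fixes n :: nat and \<sigma> :: "real \<Rightarrow> real" and T :: "real set" and v :: "real \<Rightarrow> real \<Rightarrow> real"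
  assumes "open T"
    and "\<And>t. t \<in> T \<Longrightarrow> \<sigma> t > 0"
    and "\<And>t. t \<in> T \<Longrightarrow> \<sigma> differentiable (at t)"
    and "\<And>t x. t \<in> T \<Longrightarrow> x \<in> off_nodes n \<sigma> t \<Longrightarrow> first_vlasov_at (vlasov_density n \<sigma>) v x t"
  shows "\<forall>t\<in>T.
     (\<forall>x\<in>off_nodes n \<sigma> t. velocity_equation_at n \<sigma> v (scaled_coord \<sigma> x t) t) \<and>
     (\<forall>I. open I \<and> connected I \<and> I \<subseteq> off_nodes n \<sigma> t \<longrightarrow>
        (\<exists>C. \<forall>x\<in>I. v x t = velocity_solution n \<sigma> C x t)) \<and>
     (flux_extends_continuously n \<sigma> v t \<longrightarrow>
        (\<exists>C. \<forall>x\<in>off_nodes n \<sigma> t. v x t = velocity_solution n \<sigma> C x t)) \<and>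
     (\<forall>u I. open I \<and> connected I \<and> I \<subseteq> off_nodes n \<sigma> t \<longrightarrow>
        (\<forall>x\<in>I. velocity_equation_at n \<sigma> u (scaled_coord \<sigma> x t) t)
          \<longleftrightarrow> (\<exists>C. \<forall>x\<in>I. u x t = velocity_solution n \<sigma> C x t))"
proof (intro ballI conjI)
  \<comment> \<open>Time is fixed from here on, so every constant obtained below may depend on
    \<open>t\<close>, but not on the coordinate.\<close>
  fix t assume t: "t \<in> T"
  note s = assms(2) [OF t]
  have v: "(\<lambda>z. v z t) differentiable (at x)"
    "(drift_free_flux n (\<sigma> t) (deriv \<sigma> t / \<sigma> t) (\<lambda>z. v z t) has_real_derivative 0) (at x)"
    if "x \<in> off_nodes n \<sigma> t" for x
    using first_vlasov_at_imp_DERIV_flux_0 [where v = v, OF s assms(3) [OF t] assms(4) [OF t that]]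
    by blast+
  show eq: "velocity_equation_at n \<sigma> v (scaled_coord \<sigma> x t) t" if "x \<in> off_nodes n \<sigma> t" for x
    using v [OF that] velocity_equation_at_iff [OF s that, of v] by simp
  show "\<forall>I. open I \<and> connected I \<and> I \<subseteq> off_nodes n \<sigma> t \<longrightarrow>
      (\<exists>C. \<forall>x\<in>I. v x t = velocity_solution n \<sigma> C x t)"
  proof (intro allI impI)
    fix I assume I: "open I \<and> connected I \<and> I \<subseteq> off_nodes n \<sigma> t"
    then have "\<forall>x\<in>I. velocity_equation_at n \<sigma> v (scaled_coord \<sigma> x t) t"
      using eq by blast
    then show "\<exists>C. \<forall>x\<in>I. v x t = velocity_solution n \<sigma> C x t"
      using velocity_equation_on_iff [where \<sigma> = \<sigma> and t = t and u = v, OF s] I by blast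
  qed
  show "flux_extends_continuously n \<sigma> v t \<longrightarrow>
      (\<exists>C. \<forall>x\<in>off_nodes n \<sigma> t. v x t = velocity_solution n \<sigma> C x t)"
    \<comment> \<open>Here the zero derivative of the flux is used directly at all points off the
      nodes, since \<open>off_nodes\<close> need not be connected.\<close>
    using continuous_flux_imp_velocity_solution [where \<sigma> = \<sigma> and t = t, OF s] v(2) by blast
  show "\<forall>u I. open I \<and> connected I \<and> I \<subseteq> off_nodes n \<sigma> t \<longrightarrow>
      (\<forall>x\<in>I. velocity_equation_at n \<sigma> u (scaled_coord \<sigma> x t) t)
        \<longleftrightarrow> (\<exists>C. \<forall>x\<in>I. u x t = velocity_solution n \<sigma> C x t)"
    by (intro allI impI velocity_equation_on_iff s) auto
qed

end
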